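(* Let $X$ be an Alexandroff space with topology $\tau$ and let $f:X\to X$ be a continuous self-map. Let $\mathcal{U}_\tau$ be the quasi-uniformity on $X$ given by $\mathcal{U}_\tau=\{U\subseteq X^2: U_\tau\subseteq U\}$, where $U_\tau=\{(x,y)\in X^2: y\in V(x)\}$. Then $$\mathrm{Asym}(\mathcal{U}_\tau,f)=\mathrm{SyProx}(\mathcal{U}_\tau,f)=\mathrm{Prox}(\mathcal{U}_\tau,f).$$
   Context: $\mathbb{N}$ is the set of non-negative integers. A topological space is an Alexandroff space if the intersection of every family of open sets is open; $V(x)$ denotes the smallest open set containing $x$. A subset $A\subseteq\mathbb{N}$ is syndetic if there exists $m\in\mathbb{N}$ such that $[k,k+m]\cap A\neq\emptyset$ for all $k\in\mathbb{N}$. For a quasi-uniformity $\mathcal{U}$ on $X$, a pair $(x,y)\in X^2$ and $U\in\mathcal{U}$, put $D((x,y),U)=\{k\in\mathbb{N}: (f^k(x),f^k(y))\in U\}$. Then: $\mathrm{Asym}(\mathcal{U},f)$ is the set of asymptotic pairs, i.e. pairs $(x,y)$ such that for every $U\in\mathcal{U}$ there is $n\in\mathbb{N}$ with $(f^k(x),f^k(y))\in U$ for all $k\ge n$; $\mathrm{SyProx}(\mathcal{U},f)$ is the set of syndetically proximal pairs, i.e. pairs $(x,y)$ such that $D((x,y),U)$ is a syndetic subset of $\mathbb{N}$ for every $U\in\mathcal{U}$; $\mathrm{Prox}(\mathcal{U},f)$ is the set of proximal pairs, i.e. pairs $(x,y)$ such that $D((x,y),U)$ is infinite for every $U\in\mathcal{U}$.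 *)

theory Defs
  imports "HOL-Analysis.Analysis"
begin

text \<open>The intersection is relativised to the carrier because the intersection of the empty
  family is the whole space.\<close>
definition alexandroff_space :: "'a topology \<Rightarrow> bool" where
  "alexandroff_space T \<longleftrightarrow>
     (\<forall>\<F>. (\<forall>U\<in>\<F>. openin T U) \<longrightarrow> openin T (topspace T \<inter> \<Inter>\<F>))"

text \<open>The smallest open set containing \<open>x\<close>. It is guaranteed to exist only in an Alexandroff space and
  for a point \<open>x\<close> of the space, see \<open>minimal_open\<close> below.\<close>
definition minimal_open :: "'a topology \<Rightarrow> 'a \<Rightarrow> 'a set" where
  "minimal_open T x = (LEAST U. openin T U \<and> x \<in> U)"

definition quasi_uniformity_on :: "'a set \<Rightarrow> ('a \<times> 'a) set set \<Rightarrow> bool" where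
  "quasi_uniformity_on X \<U> \<longleftrightarrow>
     \<U> \<noteq> {} \<and>
     (\<forall>U\<in>\<U>. U \<subseteq> X \<times> X \<and> Id_on X \<subseteq> U) \<and>
     (\<forall>U\<in>\<U>. \<forall>W. U \<subseteq> W \<and> W \<subseteq> X \<times> X \<longrightarrow> W \<in> \<U>) \<and>
     (\<forall>U\<in>\<U>. \<forall>W\<in>\<U>. U \<inter> W \<in> \<U>) \<and>
     (\<forall>U\<in>\<U>. \<exists>W\<in>\<U>. W O W \<subseteq> U)"

definition minimal_entourage :: "'a topology \<Rightarrow> ('a \<times> 'a) set" where
  "minimal_entourage T = {(x, y) \<in> topspace T \<times> topspace T. y \<in> minimal_open T x}"

definition alexandroff_quasi_uniformity :: "'a topology \<Rightarrow> ('a \<times> 'a) set set" where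
  "alexandroff_quasi_uniformity T =
     {U. U \<subseteq> topspace T \<times> topspace T \<and> minimal_entourage T \<subseteq> U}"

definition syndetic :: "nat set \<Rightarrow> bool" where
  "syndetic A \<longleftrightarrow> (\<exists>m. \<forall>k. {k..k + m} \<inter> A \<noteq> {})"

definition return_times :: "('a \<Rightarrow> 'a) \<Rightarrow> 'a \<times> 'a \<Rightarrow> ('a \<times> 'a) set \<Rightarrow> nat set" where
  "return_times f p U = {k. ((f ^^ k) (fst p), (f ^^ k) (snd p)) \<in> U}"

text \<open>In the following, \<open>X\<close> is the carrier set on which the family \<open>\<U>\<close> of entourages lives.\<close>

definition asymptotic_pairs ::
    "'a set \<Rightarrow> ('a \<times> 'a) set set \<Rightarrow> ('a \<Rightarrow> 'a) \<Rightarrow> ('a \<times> 'a) set" where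
  "asymptotic_pairs X \<U> f =
     {(x, y) \<in> X \<times> X. \<forall>U\<in>\<U>. \<exists>n. \<forall>k\<ge>n. ((f ^^ k) x, (f ^^ k) y) \<in> U}"

definition syndetically_proximal_pairs ::
    "'a set \<Rightarrow> ('a \<times> 'a) set set \<Rightarrow> ('a \<Rightarrow> 'a) \<Rightarrow> ('a \<times> 'a) set" where
  "syndetically_proximal_pairs X \<U> f =
     {(x, y) \<in> X \<times> X. \<forall>U\<in>\<U>. syndetic (return_times f (x, y) U)}"

definition proximal_pairs ::
    "'a set \<Rightarrow> ('a \<times> 'a) set set \<Rightarrow> ('a \<Rightarrow> 'a) \<Rightarrow> ('a \<times> 'a) set" where
  "proximal_pairs X \<U> f =
     {(x, y) \<in> X \<times> X. \<forall>U\<in>\<U>. infinite (return_times f (x, y) U)}"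

lemma minimal_open:
  assumes "alexandroff_space T" and x: "x \<in> topspace T"
  shows "openin T (minimal_open T x)"
    and "x \<in> minimal_open T x"
    and "\<And>U. openin T U \<Longrightarrow> x \<in> U \<Longrightarrow> minimal_open T x \<subseteq> U"
proof -
  define V where "V = topspace T \<inter> \<Inter>{U. openin T U \<and> x \<in> U}"
  have V: "openin T V" "x \<in> V"
    using assms unfolding V_def alexandroff_space_def by auto
  have least: "V \<subseteq> U" if "openin T U" "x \<in> U" for U
    using that unfolding V_def by auto
  have "minimal_open T x = V"
    unfolding minimal_open_def using V least by (intro Least_equality) auto
  then show "openin T (minimal_open T x)" "x \<in> minimal_open T x"
    "\<And>U. openin T U \<Longrightarrow> x \<in> U \<Longrightarrow> minimal_open T x \<subseteq> U"
    using V least by auto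
qed

lemma quasi_uniformity_on_alexandroff:
  assumes "alexandroff_space T"
  shows "quasi_uniformity_on (topspace T) (alexandroff_quasi_uniformity T)"
proof -
  let ?X = "topspace T" and ?E = "minimal_entourage T" and ?Q = "alexandroff_quasi_uniformity T"
  have mem: "U \<in> ?Q \<longleftrightarrow> U \<subseteq> ?X \<times> ?X \<and> ?E \<subseteq> U" for U
    by (simp add: alexandroff_quasi_uniformity_def)
  have "?E \<subseteq> ?X \<times> ?X"
    unfolding minimal_entourage_def by blast
  then have E: "?E \<in> ?Q"
    by (simp add: mem)
  have refl: "Id_on ?X \<subseteq> ?E"
    using minimal_open(2)[OF assms] by (auto simp: minimal_entourage_def)
  have trans: "?E O ?E \<subseteq> ?E"
  proof
    fix p assume "p \<in> ?E O ?E"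
    then obtain x y z where p: "p = (x, z)" and xy: "(x, y) \<in> ?E" and yz: "(y, z) \<in> ?E"
      by (elim relcompE)
    have x: "x \<in> ?X" and y: "y \<in> ?X" and z: "z \<in> ?X"
      and y_near: "y \<in> minimal_open T x" and z_near: "z \<in> minimal_open T y"
      using xy yz by (simp_all add: minimal_entourage_def)
    have "minimal_open T y \<subseteq> minimal_open T x"
      using minimal_open(1)[OF assms x] y_near by (rule minimal_open(3)[OF assms y])
    then show "p \<in> ?E"
      using x z z_near p by (simp add: minimal_entourage_def subset_iff)
  qed
  show ?thesis
    unfolding quasi_uniformity_on_def
  proof (intro conjI ballI allI impI)
    show "?Q \<noteq> {}" using E by blast
  next
    fix U assume "U \<in> ?Q"
    then show "U \<subseteq> ?X \<times> ?X" "Id_on ?X \<subseteq> U"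
      using refl unfolding mem by (meson subset_trans)+
  next
    fix U W assume "U \<in> ?Q" "U \<subseteq> W \<and> W \<subseteq> ?X \<times> ?X"
    then show "W \<in> ?Q" unfolding mem by (meson subset_trans)
  next
    fix U W assume "U \<in> ?Q" "W \<in> ?Q"
    then show "U \<inter> W \<in> ?Q" by (simp add: mem le_infI1)
  next
    fix U assume "U \<in> ?Q"
    then have "?E O ?E \<subseteq> U" using trans unfolding mem by (meson subset_trans)
    then show "\<exists>W\<in>?Q. W O W \<subseteq> U" using E by (rule bexI)
  qed
qed

end

theory Submission
  imports Defs
begin

text \<open>Asymptotic pairs are syndetically proximal, and these are proximal, for any family of
  entourages. Conversely, \<open>f\<close> is continuous, so it maps \<open>V(x)\<close> into \<open>V(f(x))\<close>, and the least
  entourage is forward invariant under \<open>f \<times> f\<close>. A single return of a pair to the least entourage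
  therefore keeps the pair there, and hence in every entourage, at all later times.\<close>

text \<open>The right end \<open>k + n\<close> of the window starting at \<open>k\<close> is never
  below \<open>n\<close>, so \<open>n\<close> itself serves as the gap bound for all
  \<open>k\<close>.\<close>

lemma syndetic_if_eventually:
  assumes "\<And>k. k \<ge> n \<Longrightarrow> k \<in> A"
  shows "syndetic A"
  unfolding syndetic_def
proof (intro exI allI)
  fix k
  have "k + n \<in> {k..k + n} \<inter> A"
    using assms by simp
  then show "{k..k + n} \<inter> A \<noteq> {}" by blast
qed

lemma syndetic_imp_infinite:
  assumes "syndetic A"
  shows "infinite A"
  unfolding infinite_nat_iff_unbounded_le
proof
  fix k
  obtain m where "{k..k + m} \<inter> A \<noteq> {}"
    using assms unfolding syndetic_def by blast
  then show "\<exists>n\<ge>k. n \<in> A" by auto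
qed

lemma asymptotic_subset_syndetically_proximal:
  "asymptotic_pairs X \<U> f \<subseteq> syndetically_proximal_pairs X \<U> f"
  unfolding asymptotic_pairs_def syndetically_proximal_pairs_def return_times_def
  by (fastforce intro: syndetic_if_eventually)

lemma syndetically_proximal_subset_proximal:
  "syndetically_proximal_pairs X \<U> f \<subseteq> proximal_pairs X \<U> f"
  unfolding syndetically_proximal_pairs_def proximal_pairs_def
  by (auto dest: syndetic_imp_infinite)

text \<open>By continuity the preimage of the least neighbourhood of \<open>f x\<close> is an open
  set around \<open>x\<close>, so it contains the least neighbourhood of \<open>x\<close>, and with
  it \<open>y\<close>.\<close>

lemma minimal_entourage_map:
  assumes T: "alexandroff_space T" and f: "continuous_map T T f"
    and xy: "(x, y) \<in> minimal_entourage T"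
  shows "(f x, f y) \<in> minimal_entourage T"
proof -
  have x: "x \<in> topspace T" and y: "y \<in> topspace T" and near: "y \<in> minimal_open T x"
    using xy by (simp_all add: minimal_entourage_def)
  have fx: "f x \<in> topspace T" and fy: "f y \<in> topspace T"
    using continuous_map_image_subset_topspace[OF f] x y by auto
  have "openin T {z \<in> topspace T. f z \<in> minimal_open T (f x)}"
    using f minimal_open(1)[OF T fx] by (rule openin_continuous_map_preimage)
  then have "minimal_open T x \<subseteq> {z \<in> topspace T. f z \<in> minimal_open T (f x)}"
    using x minimal_open(2)[OF T fx] by (intro minimal_open(3)[OF T x]) auto
  then show ?thesis
    using near fx fy by (auto simp: minimal_entourage_def)
qed

text \<open>Forward invariance is iterated by an induction on \<open>k\<close> that starts at the
  return time \<open>m\<close>.\<close>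

lemma minimal_entourage_funpow:
  assumes "alexandroff_space T" and "continuous_map T T f"
    and "((f ^^ m) x, (f ^^ m) y) \<in> minimal_entourage T" and "m \<le> k"
  shows "((f ^^ k) x, (f ^^ k) y) \<in> minimal_entourage T"
  using assms(4)
  by (induction k rule: dec_induct) (simp_all add: assms minimal_entourage_map)

text \<open>This allows proximality to be applied to the least entourage itself.\<close>

lemma minimal_entourage_in_quasi_uniformity:
  "minimal_entourage T \<in> alexandroff_quasi_uniformity T"
  by (auto simp: alexandroff_quasi_uniformity_def minimal_entourage_def)

lemma proximal_subset_asymptotic:
  assumes "alexandroff_space T" and "continuous_map T T f"
  shows "proximal_pairs (topspace T) (alexandroff_quasi_uniformity T) f
           \<subseteq> asymptotic_pairs (topspace T) (alexandroff_quasi_uniformity T) f"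
proof (rule subrelI)
  fix x y
  assume "(x, y) \<in> proximal_pairs (topspace T) (alexandroff_quasi_uniformity T) f"
  then have xy: "x \<in> topspace T" "y \<in> topspace T"
    and "infinite (return_times f (x, y) (minimal_entourage T))"
    using minimal_entourage_in_quasi_uniformity by (auto simp: proximal_pairs_def)
  then obtain m where "m \<in> return_times f (x, y) (minimal_entourage T)"
    using infinite_imp_nonempty by blast
  then have m: "((f ^^ m) x, (f ^^ m) y) \<in> minimal_entourage T"
    by (simp add: return_times_def)
  \<comment> \<open>The witness is \<open>n = m\<close> for every \<open>U\<close> at once, since
    each \<open>U\<close> contains the least entourage.\<close>
  have "\<exists>n. \<forall>k\<ge>n. ((f ^^ k) x, (f ^^ k) y) \<in> U" if "U \<in> alexandroff_quasi_uniformity T" for U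
    using that minimal_entourage_funpow[OF assms m]
    unfolding alexandroff_quasi_uniformity_def by blast
  then show "(x, y) \<in> asymptotic_pairs (topspace T) (alexandroff_quasi_uniformity T) f"
    using xy by (simp add: asymptotic_pairs_def)
qed

theorem theorem5:
  fixes T :: "'a topology" and f :: "'a \<Rightarrow> 'a"
  assumes "alexandroff_space T"
    and "continuous_map T T f"
  shows "asymptotic_pairs (topspace T) (alexandroff_quasi_uniformity T) f =
           syndetically_proximal_pairs (topspace T) (alexandroff_quasi_uniformity T) f \<and>
         syndetically_proximal_pairs (topspace T) (alexandroff_quasi_uniformity T) f =
           proximal_pairs (topspace T) (alexandroff_quasi_uniformity T) f"
  \<comment> \<open>The three inclusions close a cycle, which forces both equalities.\<close>
  using asymptotic_subset_syndetically_proximal syndetically_proximal_subset_proximal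
    proximal_subset_asymptotic[OF assms]
  by blast

end
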